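(* Let $G=(V,E)$ be a locally finite simple graph and $x\in V$ be an $S_1$-out regular vertex of degree $d\ge2$. Let $\Delta_{S_1''(x)}$ be the weighted Laplacian on $S_1(x)$ with weights $w''$, with second-smallest eigenvalue $\lambda_1=\lambda_1(\Delta_{S_1''(x)})$. (a) The case $\lambda_1\ge\frac d2$ is equivalent to $\infty$-curvature sharpness of $x$. In this case, for all $\mathcal N\in(0,\infty]$, $$\mathcal K_{G,x}(\mathcal N)=\frac{3+d-av_1^+(x)}2-\frac{2d}{\mathcal N}.$$ (b) If $\lambda_1<\frac d2$, then for all $\mathcal N\in(0,\infty]$, $$\mathcal K_{G,x}(\mathcal N)=\begin{cases}\frac{3+d-av_1^+(x)}2-\frac{2d}{\mathcal N},&\text{if }\mathcal N\le\frac{2d}{d-2\lambda_1},\\[1mm]\frac{3-d-av_1^+(x)}2+2\lambda_1,&\text{if }\mathcal N>\frac{2d}{d-2\lambda_1}.\end{cases}$$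
   Context: Graphs are undirected, without loops or multiple edges, and every vertex has finite degree. For $f:V\to\mathbb R$ put $\Delta f(x)=\sum_{y\sim x}(f(y)-f(x))$ (non-normalized Laplacian), and for $f,g:V\to\mathbb R$ put $2\Gamma(f,g)=\Delta(fg)-f\Delta g-g\Delta f$, $2\Gamma_2(f,g)=\Delta\Gamma(f,g)-\Gamma(f,\Delta g)-\Gamma(\Delta f,g)$, $\Gamma(f)=\Gamma(f,f)$, $\Gamma_2(f)=\Gamma_2(f,f)$. For $\mathcal N\in(0,\infty]$ (convention $1/\infty=0$), $\mathcal K_{G,x}(\mathcal N)$ is the largest $K\in\mathbb R$ such that $\Gamma_2(f)(x)\ge\frac1{\mathcal N}(\Delta f(x))^2+K\,\Gamma(f)(x)$ for all $f:V\to\mathbb R$ (Bakry-Émery curvature function). $S_r(x)$ is the set of vertices at graph distance $r$ from $x$; $S_1(x)=\{y_1,\dots,y_d\}$. For $y\in S_1(x)$, the out degree $d_y^+$ is the number of neighbours of $y$ in $S_2(x)$; for $z\in S_2(x)$, $d_z^-$ is the number of neighbours of $z$ in $S_1(x)$; $av_1^+(x)=\frac1d\sum_{y\in S_1(x)}d_y^+$. The vertex $x$ is $S_1$-out regular if all $y\in S_1(x)$ have the same out degree. The vertex $x$ is $\infty$-curvature sharp if $\mathcal K_{G,x}(\infty)=\frac{3+d-av_1^+(x)}2$. Let $w_{uv}=1$ if $u\sim v$ in $G$ and $0$ otherwise. For $i\ne j$ put $w'_{y_iy_j}=\sum_{z\in S_2(x)}\frac{w_{y_iz}w_{zy_j}}{d_z^-}$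 and $w''_{y_iy_j}=w_{y_iy_j}+w'_{y_iy_j}$. The weighted Laplacian $\Delta_{S_1''(x)}$ acts on functions $f:S_1(x)\to\mathbb R$ by $\Delta_{S_1''(x)}f(y_i)=\sum_{j\ne i}w''_{y_iy_j}(f(y_j)-f(y_i))$. Its eigenvalues are the $\lambda$ with $\Delta_{S_1''(x)}f+\lambda f=0$ for some $f\neq0$, ordered with multiplicity as $0=\lambda_0\le\lambda_1\le\dots\le\lambda_{d-1}$. *)

theory Defs
  imports "HOL-Analysis.Analysis" "HOL-Library.Function_Algebras" "HOL-Library.Extended_Nat"
begin

text \<open>A graph is given by its vertex set \<open>V\<close> and its edge set \<open>E\<close>, whose members are unordered
  pairs \<open>{u, v}\<close> of distinct vertices. Since edges join members of \<open>V\<close> only, every notion below is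
  local to \<open>x\<close> and depends on \<open>E\<close> alone; functions on \<open>V\<close> are represented by functions on the
  whole type, their values outside \<open>V\<close> never being used when \<open>x \<in> V\<close>.\<close>

definition locally_finite_simple_graph :: "'a set \<Rightarrow> 'a set set \<Rightarrow> bool" where
  "locally_finite_simple_graph V E \<longleftrightarrow>
     (\<forall>e\<in>E. \<exists>u\<in>V. \<exists>v\<in>V. u \<noteq> v \<and> e = {u, v}) \<and>
     (\<forall>u\<in>V. finite {v. {u, v} \<in> E})"

definition nbrs :: "'a set set \<Rightarrow> 'a \<Rightarrow> 'a set" where
  "nbrs E u = {v. {u, v} \<in> E}"

definition vertex_degree :: "'a set set \<Rightarrow> 'a \<Rightarrow> nat" where
  "vertex_degree E x = card (nbrs E x)"

text \<open>Length of a shortest walk; \<open>\<infinity>\<close> if there is none.\<close>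

definition graph_dist :: "'a set set \<Rightarrow> 'a \<Rightarrow> 'a \<Rightarrow> enat" where
  "graph_dist E u v = Inf {enat n | n. (u, v) \<in> {(a, b). {a, b} \<in> E} ^^ n}"

definition sphere_at :: "'a set set \<Rightarrow> nat \<Rightarrow> 'a \<Rightarrow> 'a set" where
  "sphere_at E r x = {v. graph_dist E x v = enat r}"

definition lap :: "'a set set \<Rightarrow> ('a \<Rightarrow> real) \<Rightarrow> 'a \<Rightarrow> real" where
  "lap E f x = (\<Sum>y\<in>nbrs E x. f y - f x)"

definition Gam :: "'a set set \<Rightarrow> ('a \<Rightarrow> real) \<Rightarrow> ('a \<Rightarrow> real) \<Rightarrow> 'a \<Rightarrow> real" where
  "Gam E f g x = (lap E (\<lambda>y. f y * g y) x - f x * lap E g x - g x * lap E f x) / 2"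

definition Gam2 :: "'a set set \<Rightarrow> ('a \<Rightarrow> real) \<Rightarrow> ('a \<Rightarrow> real) \<Rightarrow> 'a \<Rightarrow> real" where
  "Gam2 E f g x = (lap E (Gam E f g) x - Gam E f (lap E g) x - Gam E (lap E f) g x) / 2"

text \<open>The dimension \<open>N\<close> ranges over \<open>(0, \<infinity>]\<close>; in \<^typ>\<open>ereal\<close> we have \<open>1 / \<infinity> = 0\<close>. As
  \<open>GREATEST\<close> denotes an unspecified number when there is no largest \<open>K\<close>, an equation for
  \<open>BE_curvature\<close> carries the claim that the largest \<open>K\<close> exists.\<close>

definition BE_curvature :: "'a set set \<Rightarrow> 'a \<Rightarrow> ereal \<Rightarrow> real" where
  "BE_curvature E x N =
     (GREATEST K. \<forall>f. Gam2 E f f x \<ge> real_of_ereal (1 / N) * (lap E f x)\<^sup>2 + K * Gam E f f x)"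

definition out_degree :: "'a set set \<Rightarrow> 'a \<Rightarrow> 'a \<Rightarrow> nat" where
  "out_degree E x y = card (nbrs E y \<inter> sphere_at E 2 x)"

definition in_degree :: "'a set set \<Rightarrow> 'a \<Rightarrow> 'a \<Rightarrow> nat" where
  "in_degree E x z = card (nbrs E z \<inter> sphere_at E 1 x)"

definition av_out_degree :: "'a set set \<Rightarrow> 'a \<Rightarrow> real" where
  "av_out_degree E x = 1 / real (vertex_degree E x) * (\<Sum>y\<in>sphere_at E 1 x. real (out_degree E x y))"

definition S1_out_regular :: "'a set set \<Rightarrow> 'a \<Rightarrow> bool" where
  "S1_out_regular E x \<longleftrightarrow>
     (\<forall>y\<in>sphere_at E 1 x. \<forall>y'\<in>sphere_at E 1 x. out_degree E x y = out_degree E x y')"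

definition infty_curvature_sharp :: "'a set set \<Rightarrow> 'a \<Rightarrow> bool" where
  "infty_curvature_sharp E x \<longleftrightarrow>
     BE_curvature E x \<infinity> = (3 + real (vertex_degree E x) - av_out_degree E x) / 2"

definition edge_weight :: "'a set set \<Rightarrow> 'a \<Rightarrow> 'a \<Rightarrow> real" where
  "edge_weight E u v = (if {u, v} \<in> E then 1 else 0)"

definition weight1 :: "'a set set \<Rightarrow> 'a \<Rightarrow> 'a \<Rightarrow> 'a \<Rightarrow> real" where
  "weight1 E x y y' =
     (\<Sum>z\<in>sphere_at E 2 x. edge_weight E y z * edge_weight E z y' / real (in_degree E x z))"

definition weight2 :: "'a set set \<Rightarrow> 'a \<Rightarrow> 'a \<Rightarrow> 'a \<Rightarrow> real" where
  "weight2 E x y y' = edge_weight E y y' + weight1 E x y y'"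

definition weighted_lap :: "'a set \<Rightarrow> ('a \<Rightarrow> 'a \<Rightarrow> real) \<Rightarrow> ('a \<Rightarrow> real) \<Rightarrow> 'a \<Rightarrow> real" where
  "weighted_lap S w f y = (\<Sum>y'\<in>S - {y}. w y y' * (f y' - f y))"

global_interpretation fun_space: vector_space "\<lambda>(c::real) (f::'a \<Rightarrow> real) y. c * f y"
  by unfold_locales (auto simp: fun_eq_iff algebra_simps)

text \<open>Functions on \<open>S\<close> are represented by functions vanishing outside \<open>S\<close>.\<close>

definition lap_eigenspace ::
    "'a set \<Rightarrow> ('a \<Rightarrow> 'a \<Rightarrow> real) \<Rightarrow> real \<Rightarrow> ('a \<Rightarrow> real) set" where
  "lap_eigenspace S w l =
     {f. (\<forall>y. y \<notin> S \<longrightarrow> f y = 0) \<and> (\<forall>y\<in>S. weighted_lap S w f y + l * f y = 0)}"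

definition lap_eigenvalues :: "'a set \<Rightarrow> ('a \<Rightarrow> 'a \<Rightarrow> real) \<Rightarrow> real set" where
  "lap_eigenvalues S w = {l. \<exists>f\<in>lap_eigenspace S w l. f \<noteq> (\<lambda>_. 0)}"

text \<open>The increasing list of eigenvalues, each repeated according to the dimension of its
  eigenspace.\<close>

definition lap_spectrum :: "'a set \<Rightarrow> ('a \<Rightarrow> 'a \<Rightarrow> real) \<Rightarrow> real list" where
  "lap_spectrum S w =
     concat (map (\<lambda>l. replicate (fun_space.dim (lap_eigenspace S w l)) l)
                 (sorted_list_of_set (lap_eigenvalues S w)))"

definition lambda1 :: "'a set set \<Rightarrow> 'a \<Rightarrow> real" where
  "lambda1 E x = lap_spectrum (sphere_at E 1 x) (weight2 E x) ! 1"

end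

theory Submission
  imports Defs
begin

text \<open>Write \<open>a = f - f x\<close>. Minimising \<open>Gam2 f x\<close> over the values of
  \<open>f\<close> on the two-sphere (completing the square at each \<open>z\<close>) leaves the
  quadratic form \<open>(3 - d - D) / 2 * |a|^2 + (sum of a)^2 + 2 * (Dirichlet energy of a for the
  weights w'')\<close> on the one-sphere for twice the minimum, \<open>D\<close> being the common
  out degree. Since \<open>2 Gam f x = |a|^2\<close> and \<open>lap f x\<close> is the sum of
  \<open>a\<close>, the splitting of \<open>a\<close> into its mean and a mean-zero part
  diagonalises the curvature inequality: constants allow \<open>K\<close> up to \<open>(3 + d - D) /
  2 - 2 d / N\<close>, mean-zero functions up to \<open>(3 - d - D) / 2 + 2 lambda1\<close>, and the
  curvature is the minimum of the two.\<close>

section \<open>The Rayleigh quotient of a weighted Laplacian\<close>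

lemma sum_fun_apply: "(\<Sum>i\<in>I. F i) y = (\<Sum>i\<in>I. F i y)" for F :: "'b \<Rightarrow> 'a \<Rightarrow> real"
  by (induction I rule: infinite_finite_induct) auto

text \<open>First-order condition at a minimum: for small \<open>t\<close> the linear term
  dominates, so \<open>p \<noteq> 0\<close> would make the polynomial negative on one side of 0. It
  supplies the Euler-Lagrange equation of the Rayleigh quotient.\<close>

lemma linear_coeff_zero:
  fixes p q :: real
  assumes "\<And>t. 0 \<le> 2 * t * p + t\<^sup>2 * q"
  shows "p = 0"
proof (rule ccontr)
  assume "p \<noteq> 0"
  have "((\<lambda>t. 2 * p + t * q) \<longlongrightarrow> 2 * p + 0 * q) (at 0)"
    by (intro tendsto_intros)
  hence lim: "((\<lambda>t. p * (2 * p + t * q)) \<longlongrightarrow> p * (2 * p)) (at 0)"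
    by (intro tendsto_mult tendsto_const) simp
  have "p * (2 * p) > 0"
    using \<open>p \<noteq> 0\<close> by (simp add: power2_eq_square[symmetric] mult.left_commute)
  from order_tendstoD(1)[OF lim this] obtain e where e: "e > 0"
    "\<And>t. t \<noteq> 0 \<Longrightarrow> \<bar>t\<bar> < e \<Longrightarrow> p * (2 * p + t * q) > 0"
    by (auto simp: eventually_at)
  \<comment> \<open>Opposite in sign to \<open>p\<close>, yet small enough that
    \<open>2 * p + t * q\<close> keeps the sign of \<open>p\<close>.\<close>
  define t where "t = - sgn p * (e / 2)"
  have t: "t \<noteq> 0" "\<bar>t\<bar> < e" "t * p < 0"
    using \<open>p \<noteq> 0\<close> \<open>e > 0\<close> by (auto simp: t_def sgn_if abs_mult mult_pos_neg)
  have "0 \<le> t * (2 * p + t * q)"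
    using assms[of t] by (simp add: power2_eq_square algebra_simps)
  hence "0 \<le> p\<^sup>2 * (t * (2 * p + t * q))"
    by simp
  also have "\<dots> = (t * p) * (p * (2 * p + t * q))"
    by (simp add: power2_eq_square)
  also have "\<dots> < 0"
    using t e(2)[of t] by (simp add: mult_neg_pos)
  finally show False by simp
qed

section \<open>Dirichlet form, Green's formula and the weak eigenvalue equation\<close>

locale finite_network =
  fixes S :: "'a set" and w :: "'a \<Rightarrow> 'a \<Rightarrow> real"
  assumes finite_S: "finite S"
    and w_sym: "w y y' = w y' y"
    and w_nonneg: "0 \<le> w y y'"
begin

text \<open>The Dirichlet form; the double sum meets every unordered pair twice, hence the division
  by 2.\<close>

definition energy :: "('a \<Rightarrow> real) \<Rightarrow> ('a \<Rightarrow> real) \<Rightarrow> real" where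
  "energy f g = (\<Sum>y\<in>S. \<Sum>y'\<in>S. w y y' * ((f y' - f y) * (g y' - g y))) / 2"

definition ip :: "('a \<Rightarrow> real) \<Rightarrow> ('a \<Rightarrow> real) \<Rightarrow> real" where
  "ip f g = (\<Sum>y\<in>S. f y * g y)"

lemma ip_commute: "ip f g = ip g f"
  by (simp add: ip_def mult.commute)

lemma energy_commute: "energy f g = energy g f"
  by (simp add: energy_def mult.commute)

lemma energy_nonneg: "0 \<le> energy f f"
  unfolding energy_def by (intro divide_nonneg_nonneg sum_nonneg mult_nonneg_nonneg w_nonneg zero_le_square) auto

lemma ip_nonneg: "0 \<le> ip f f"
  unfolding ip_def by (intro sum_nonneg) auto

lemma ip_eq_0D: "ip f f = 0 \<Longrightarrow> y \<in> S \<Longrightarrow> f y = 0"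
  using finite_S by (simp add: ip_def sum_nonneg_eq_0_iff)

lemma ip_expand: "ip (\<lambda>y. f y + t * g y) (\<lambda>y. f y + t * g y)
    = ip f f + 2 * t * ip f g + t\<^sup>2 * ip g g"
  unfolding ip_def by (simp add: algebra_simps sum.distrib power2_eq_square sum_distrib_left)

lemma energy_expand: "energy (\<lambda>y. f y + t * g y) (\<lambda>y. f y + t * g y)
    = energy f f + 2 * t * energy f g + t\<^sup>2 * energy g g"
proof -
  have "(\<Sum>y\<in>S. \<Sum>y'\<in>S. w y y' * (((f y' + t * g y') - (f y + t * g y)) * ((f y' + t * g y') - (f y + t * g y))))
    = (\<Sum>y\<in>S. \<Sum>y'\<in>S. w y y' * ((f y' - f y) * (f y' - f y))
        + 2 * t * (w y y' * ((f y' - f y) * (g y' - g y)))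
        + t\<^sup>2 * (w y y' * ((g y' - g y) * (g y' - g y))))"
    by (intro sum.cong refl) (simp add: algebra_simps power2_eq_square)
  thus ?thesis
    unfolding energy_def by (simp add: sum.distrib sum_distrib_left[symmetric] add_divide_distrib)
qed

lemma energy_shift: "energy (\<lambda>y. f y + c) (\<lambda>y. f y + c) = energy f f"
  by (simp add: energy_def)

text \<open>The diagonal term has difference 0, so \<open>w y y\<close> may be nonzero, as it is in
  general for \<open>weight2\<close>.\<close>

lemma weighted_lap_eq: "weighted_lap S w f y = (\<Sum>y'\<in>S. w y y' * (f y' - f y))"
  unfolding weighted_lap_def by (rule sum.mono_neutral_left) (auto simp: finite_S)

text \<open>Summation by parts: averaging the sum with its copy under exchange of \<open>y\<close>
  and \<open>y'\<close> turns \<open>g y\<close> into half of a difference of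
  \<open>g\<close>.\<close>

lemma green: "ip g (weighted_lap S w f) = - energy f g"
proof -
  define A where "A = (\<Sum>y\<in>S. \<Sum>y'\<in>S. w y y' * ((f y' - f y) * g y))"
  have "A = (\<Sum>y\<in>S. \<Sum>y'\<in>S. w y y' * ((f y - f y') * g y'))"
    unfolding A_def by (subst sum.swap) (simp add: w_sym)
  hence "2 * A = (\<Sum>y\<in>S. \<Sum>y'\<in>S. w y y' * ((f y' - f y) * g y) + w y y' * ((f y - f y') * g y'))"
    by (simp add: sum.distrib A_def)
  also have "\<dots> = (\<Sum>y\<in>S. \<Sum>y'\<in>S. - (w y y' * ((f y' - f y) * (g y' - g y))))"
    by (intro sum.cong refl) (simp add: algebra_simps)
  finally have "2 * A = - 2 * energy f g"
    by (simp add: energy_def sum_negf)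
  moreover have "ip g (weighted_lap S w f) = A"
    by (simp add: ip_def weighted_lap_eq A_def sum_distrib_left mult_ac)
  ultimately show ?thesis by simp
qed

lemma eigenfunction_energy:
  assumes "f \<in> lap_eigenspace S w l"
  shows "energy f g = l * ip f g"
proof -
  have "ip g (weighted_lap S w f) = (\<Sum>y\<in>S. g y * (- l * f y))"
    unfolding ip_def using assms
    by (intro sum.cong refl arg_cong2[where f = "(*)"]) (auto simp: lap_eigenspace_def eq_neg_iff_add_eq_0)
  also have "\<dots> = - l * ip f g"
    by (simp add: ip_def sum_distrib_left sum_negf mult_ac)
  finally show ?thesis using green[of g f] by simp
qed

text \<open>Converse of \<open>eigenfunction_energy\<close>: testing the weak equation against the
  indicator of a point gives the equation at that point.\<close>

lemma eigenspaceI: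
  assumes "\<And>y. y \<notin> S \<Longrightarrow> f y = 0" and "\<And>g. energy f g = l * ip f g"
  shows "f \<in> lap_eigenspace S w l"
  unfolding lap_eigenspace_def
proof safe
  fix y assume y: "y \<in> S"
  have ip: "ip (indicator {y}) h = h y" for h
    using y finite_S by (simp add: ip_def indicator_def sum.delta if_distrib[of "\<lambda>t. t * _"] cong: if_cong)
  show "weighted_lap S w f y + l * f y = 0"
    using green[of "indicator {y}" f] assms(2)[of "indicator {y}"] ip ip_commute[of f "indicator {y}"]
    by simp
qed (use assms in auto)

text \<open>\<open>ip\<close> sees only values on \<open>S\<close>; it is definite on eigenspaces
  because their members vanish outside \<open>S\<close>.\<close>

lemma eigenspace_zeroI:
  assumes "f \<in> lap_eigenspace S w l" "ip f f = 0"
  shows "f = (\<lambda>_. 0)"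
  using assms ip_eq_0D[OF assms(2)] by (auto simp: lap_eigenspace_def fun_eq_iff)

lemma eigenspace_orthogonal:
  assumes "f \<in> lap_eigenspace S w l" "g \<in> lap_eigenspace S w m" "l \<noteq> m"
  shows "ip f g = 0"
  using eigenfunction_energy[OF assms(1), of g] eigenfunction_energy[OF assms(2), of f]
    energy_commute[of f g] ip_commute[of f g] assms(3) by simp

lemma indicator_eigenspace: "indicator S \<in> lap_eigenspace S w 0"
  by (auto simp: lap_eigenspace_def weighted_lap_def)

lemma ip_indicator: "ip f (indicator S) = sum f S"
  by (simp add: ip_def)

section \<open>Independence, multiplicities and finiteness of the spectrum\<close>

lemma supported_in_span:
  assumes "\<And>y. y \<notin> S \<Longrightarrow> f y = 0"
  shows "f \<in> fun_space.span ((\<lambda>y. indicator {y}) ` S)"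
proof -
  have "f = (\<Sum>y\<in>S. (\<lambda>z. f y * indicator {y} z))"
  proof
    fix z
    have "(\<Sum>y\<in>S. f y * indicator {y} z) = (\<Sum>y\<in>S. if y = z then f y else 0)"
      by (intro sum.cong refl) auto
    thus "f z = (\<Sum>y\<in>S. (\<lambda>z. f y * indicator {y} z)) z"
      using assms[of z] finite_S by (simp add: sum_fun_apply)
  qed
  also have "\<dots> \<in> fun_space.span ((\<lambda>y. indicator {y}) ` S)"
    by (intro fun_space.span_sum fun_space.span_scale fun_space.span_base) auto
  finally show ?thesis .
qed

text \<open>Pairing a vanishing combination with one of its members isolates the coefficient of that
  member.\<close>

lemma orthogonal_independent:
  assumes "\<And>f g. f \<in> B \<Longrightarrow> g \<in> B \<Longrightarrow> f \<noteq> g \<Longrightarrow> ip f g = 0"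
    and "\<And>f. f \<in> B \<Longrightarrow> ip f f \<noteq> 0"
  shows "fun_space.independent B"
  unfolding fun_space.independent_explicit_module
proof (intro allI impI)
  fix T u v
  assume T: "finite T" "T \<subseteq> B" "v \<in> T" and zero: "(\<Sum>f\<in>T. (\<lambda>y. u f * f y)) = 0"
  have "0 = ip (\<Sum>f\<in>T. (\<lambda>y. u f * f y)) v"
    by (simp add: zero ip_def)
  also have "\<dots> = (\<Sum>f\<in>T. u f * ip f v)"
    by (simp add: ip_def sum_fun_apply sum_distrib_right sum_distrib_left mult_ac)
       (rule sum.swap)
  also have "\<dots> = (\<Sum>f\<in>T. if f = v then u v * ip v v else 0)"
    using T by (intro sum.cong refl) (use assms(1) in auto)
  also have "\<dots> = u v * ip v v"
    using T by simp
  finally show "u v = 0"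
    using assms(2)[of v] T by auto
qed

text \<open>The ambient space of all functions may be infinite-dimensional, but functions supported
  on \<open>S\<close> lie in the span of finitely many point indicators.\<close>

lemma finite_independent:
  assumes "fun_space.independent B" "\<And>f y. f \<in> B \<Longrightarrow> y \<notin> S \<Longrightarrow> f y = 0"
  shows "finite B"
proof -
  have "B \<subseteq> fun_space.span ((\<lambda>y. indicator {y}) ` S)"
    using assms(2) supported_in_span by blast
  thus ?thesis
    using fun_space.independent_span_bound[OF _ assms(1), of "(\<lambda>y. indicator {y}) ` S"] finite_S by auto
qed

lemma card_le_dim_eigenspace:
  assumes "fun_space.independent B" "B \<subseteq> lap_eigenspace S w l"
  shows "card B \<le> fun_space.dim (lap_eigenspace S w l)"
proof -
  obtain C where C: "C \<subseteq> lap_eigenspace S w l" "fun_space.independent C"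
    "lap_eigenspace S w l \<subseteq> fun_space.span C" "card C = fun_space.dim (lap_eigenspace S w l)"
    by (rule fun_space.basis_exists)
  have "finite C"
    by (rule finite_independent[OF C(2)]) (use C(1) in \<open>auto simp: lap_eigenspace_def\<close>)
  thus ?thesis
    using fun_space.independent_span_bound[OF _ assms(1), of C] assms(2) C by auto
qed

text \<open>Eigenfunctions chosen for distinct eigenvalues are orthogonal, hence an independent
  family supported on \<open>S\<close>. Finiteness matters because \<open>sorted_list_of_set\<close>
  returns the empty list on infinite sets.\<close>

lemma finite_eigenvalues: "finite (lap_eigenvalues S w)"
proof -
  define F where "F = (\<lambda>l. SOME f. f \<in> lap_eigenspace S w l \<and> f \<noteq> (\<lambda>_. 0))"
  have F: "F l \<in> lap_eigenspace S w l" "ip (F l) (F l) \<noteq> 0" if "l \<in> lap_eigenvalues S w" for l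
  proof -
    have *: "F l \<in> lap_eigenspace S w l \<and> F l \<noteq> (\<lambda>_. 0)"
      unfolding F_def
      by (rule someI_ex[of "\<lambda>f. f \<in> lap_eigenspace S w l \<and> f \<noteq> (\<lambda>_. 0)"])
        (use that in \<open>auto simp: lap_eigenvalues_def\<close>)
    thus "F l \<in> lap_eigenspace S w l" "ip (F l) (F l) \<noteq> 0"
      using eigenspace_zeroI[of "F l" l] by auto
  qed
  have "fun_space.independent (F ` lap_eigenvalues S w)"
  proof (rule orthogonal_independent)
    fix f g assume "f \<in> F ` lap_eigenvalues S w" "g \<in> F ` lap_eigenvalues S w" "f \<noteq> g"
    then obtain l m where "f = F l" "g = F m" "l \<in> lap_eigenvalues S w" "m \<in> lap_eigenvalues S w" "l \<noteq> m"
      by blast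
    thus "ip f g = 0"
      using F(1) eigenspace_orthogonal by blast
  qed (use F(2) in blast)
  hence "finite (F ` lap_eigenvalues S w)"
    by (rule finite_independent) (use F(1) in \<open>auto simp: lap_eigenspace_def\<close>)
  moreover have "inj_on F (lap_eigenvalues S w)"
  proof (rule inj_onI, rule ccontr)
    fix l m assume lm: "l \<in> lap_eigenvalues S w" "m \<in> lap_eigenvalues S w" "F l = F m" "l \<noteq> m"
    hence "ip (F l) (F m) = 0"
      using F(1) eigenspace_orthogonal by blast
    thus False
      using F(2)[of l] lm by simp
  qed
  ultimately show ?thesis
    by (rule finite_imageD)
qed

section \<open>Variational characterisation of the second eigenvalue\<close>

lemma exists_rayleigh_minimizer:
  assumes "card S \<ge> 2"
  obtains v where "\<And>y. y \<notin> S \<Longrightarrow> v y = 0" "sum v S = 0" "ip v v = 1"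
    "\<And>g. sum g S = 0 \<Longrightarrow> energy v v * ip g g \<le> energy g g"
proof -
  \<comment> \<open>The unit sphere of mean-zero functions on \<open>S\<close>. Factors
    \<open>{0}\<close> outside \<open>S\<close> and \<open>{-1..1}\<close> on \<open>S\<close> make
    it a closed subset of a product of compact sets, hence compact by Tychonoff.\<close>
  define C where "C = (PiE UNIV (\<lambda>y. if y \<in> S then {-1..1::real} else {0}))
    \<inter> {f. sum f S = 0} \<inter> {f. ip f f = 1}"
  have cont: "continuous_on UNIV (\<lambda>f :: 'a \<Rightarrow> real. f y)" for y
    by simp
  have "compactin (product_topology (\<lambda>_. euclidean) UNIV)
      (PiE UNIV (\<lambda>y. if y \<in> S then {-1..1::real} else {0}))"
    by (subst compactin_PiE) auto
  hence "compact (PiE UNIV (\<lambda>y. if y \<in> S then {-1..1::real} else {0}))"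
    by (simp add: euclidean_product_topology)
  moreover have "closed {f. sum f S = (0::real)}"
    by (intro closed_Collect_eq continuous_on_sum continuous_on_const cont)
  moreover have "closed {f. ip f f = 1}"
    unfolding ip_def
    by (intro closed_Collect_eq continuous_on_sum continuous_on_mult continuous_on_const cont)
  ultimately have "compact C"
    unfolding C_def by (intro compact_Int_closed)
  have in_C: "f \<in> C" if "\<And>y. y \<notin> S \<Longrightarrow> f y = 0" "sum f S = 0" "ip f f = 1" for f
  proof -
    have "(f y)\<^sup>2 \<le> 1" if "y \<in> S" for y
      using member_le_sum[of y S "\<lambda>y. f y * f y"] that finite_S \<open>ip f f = 1\<close>
      by (simp add: ip_def power2_eq_square)
    hence "\<bar>f y\<bar> \<le> 1" if "y \<in> S" for y
      using that abs_le_square_iff[of "f y" 1] by simp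
    thus ?thesis
      using that by (auto simp: C_def PiE_def abs_le_iff)
  qed
  have normalize: "(\<lambda>y. if y \<in> S then g y / sqrt (ip g g) else 0) \<in> C"
    if "sum g S = 0" "ip g g > 0" for g
  proof (rule in_C)
    show "(\<Sum>y\<in>S. if y \<in> S then g y / sqrt (ip g g) else 0) = 0"
      using that by (simp add: sum_divide_distrib[symmetric])
    have "ip (\<lambda>y. if y \<in> S then g y / sqrt (ip g g) else 0) (\<lambda>y. if y \<in> S then g y / sqrt (ip g g) else 0)
        = (\<Sum>y\<in>S. g y * g y / ip g g)"
      unfolding ip_def[of "\<lambda>y. if y \<in> S then _ y else _"] using that by (intro sum.cong refl) simp
    thus "ip (\<lambda>y. if y \<in> S then g y / sqrt (ip g g) else 0)
        (\<lambda>y. if y \<in> S then g y / sqrt (ip g g) else 0) = 1"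
      using that by (simp add: sum_divide_distrib[symmetric] ip_def[symmetric])
  qed auto
  have "\<exists>p q. p \<in> S \<and> q \<in> S \<and> p \<noteq> q"
  proof -
    obtain T where "T \<subseteq> S" "card T = 2"
      using assms by (meson obtain_subset_with_card_n)
    thus ?thesis by (auto simp: card_2_iff)
  qed
  then obtain p q where pq: "p \<in> S" "q \<in> S" "p \<noteq> q" by blast
  \<comment> \<open>Two distinct points of \<open>S\<close> give a nonzero mean-zero function, so
    \<open>C\<close> is nonempty.\<close>
  define h where "h = (\<lambda>y. indicator {p} y - indicator {q} y :: real)"
  have "sum h S = 0"
    using pq finite_S by (simp add: h_def sum_subtractf indicator_def)
  moreover have "ip h h \<noteq> 0"
    using ip_eq_0D[of h p] pq by (auto simp: h_def)
  ultimately have "C \<noteq> {}"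
    using normalize[of h] ip_nonneg[of h] by auto
  moreover have "continuous_on C (\<lambda>f. energy f f)"
    unfolding energy_def
    by (intro continuous_intros continuous_on_sum continuous_on_subset[OF cont]) auto
  ultimately obtain v where v: "v \<in> C" "\<And>f. f \<in> C \<Longrightarrow> energy v v \<le> energy f f"
    using continuous_attains_inf[OF \<open>compact C\<close>, of "\<lambda>f. energy f f"] by blast
  show ?thesis
  proof
    show "v y = 0" if "y \<notin> S" for y
    proof -
      have "v y \<in> (if y \<in> S then {-1..1} else {0})"
        using v(1) by (auto simp: C_def PiE_def Pi_def)
      thus ?thesis using that by simp
    qed
    show "sum v S = 0" "ip v v = 1"
      using v(1) by (auto simp: C_def)
    fix g :: "'a \<Rightarrow> real" assume g: "sum g S = 0"
    show "energy v v * ip g g \<le> energy g g"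
    proof (cases "ip g g = 0")
      case True
      thus ?thesis using energy_nonneg by simp
    next
      case False
      hence pos: "ip g g > 0" using ip_nonneg[of g] by simp
      have "energy v v \<le> energy (\<lambda>y. if y \<in> S then g y / sqrt (ip g g) else 0)
          (\<lambda>y. if y \<in> S then g y / sqrt (ip g g) else 0)"
        by (intro v(2) normalize g pos)
      also have "\<dots> = (\<Sum>y\<in>S. \<Sum>y'\<in>S. w y y' * ((g y' - g y) * (g y' - g y)) / ip g g) / 2"
        unfolding energy_def using pos
        by (intro arg_cong2[where f = "(/)"] sum.cong refl) (simp add: diff_divide_distrib[symmetric])
      also have "\<dots> = energy g g / ip g g"
        by (simp add: energy_def sum_divide_distrib[symmetric])
      finally show ?thesis
        using pos by (simp add: field_simps)
    qed
  qed
qed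

text \<open>Perturbing \<open>v\<close> by a mean-zero function gives the weak equation for such
  test functions. Subtracting its mean from an arbitrary \<open>g\<close> changes neither side:
  energy ignores constants, and \<open>v\<close> is orthogonal to them.\<close>

lemma rayleigh_minimizer_eigen:
  assumes "\<And>y. y \<notin> S \<Longrightarrow> v y = 0" "sum v S = 0" "ip v v = 1"
    and min: "\<And>g. sum g S = 0 \<Longrightarrow> energy v v * ip g g \<le> energy g g"
  shows "v \<in> lap_eigenspace S w (energy v v)"
proof (rule eigenspaceI)
  fix g
  define c where "c = sum g S / card S"
  define h where "h = (\<lambda>y. g y - c)"
  have "S \<noteq> {}"
    using assms(3) by (auto simp: ip_def)
  hence sum_h: "sum h S = 0"
    using finite_S by (simp add: h_def c_def sum_subtractf)
  have "energy v h - energy v v * ip v h = 0"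
  proof (rule linear_coeff_zero)
    fix t
    have "energy v v * ip (\<lambda>y. v y + t * h y) (\<lambda>y. v y + t * h y)
        \<le> energy (\<lambda>y. v y + t * h y) (\<lambda>y. v y + t * h y)"
      by (rule min) (simp add: sum.distrib sum_distrib_left[symmetric] assms(2) sum_h)
    thus "0 \<le> 2 * t * (energy v h - energy v v * ip v h) + t\<^sup>2 * (energy h h - energy v v * ip h h)"
      unfolding ip_expand energy_expand by (simp add: assms(3) algebra_simps)
  qed
  moreover have "energy v h = energy v g"
    by (simp add: energy_def h_def)
  moreover have "ip v h = ip v g - c * sum v S"
    by (simp add: ip_def h_def algebra_simps sum_subtractf sum_distrib_left)
  ultimately show "energy v g = energy v v * ip v g"
    using assms(2) by simp
qed (use assms in auto)

text \<open>The minimum \<open>\<mu>\<close> of the Rayleigh quotient is an eigenvalue, and no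
  nonzero eigenvalue is smaller, since its eigenfunctions are orthogonal to constants. What remains
  is to locate \<open>\<mu>\<close> at index 1 of the list, which depends on the multiplicity of
  0.\<close>

lemma lap_spectrum_second:
  assumes "card S \<ge> 2"
  obtains v where "sum v S = 0" "ip v v = 1" "energy v v = lap_spectrum S w ! 1"
    "\<And>g. sum g S = 0 \<Longrightarrow> lap_spectrum S w ! 1 * ip g g \<le> energy g g"
proof -
  obtain v where v: "\<And>y. y \<notin> S \<Longrightarrow> v y = 0" "sum v S = 0" "ip v v = 1"
    and min: "\<And>g. sum g S = 0 \<Longrightarrow> energy v v * ip g g \<le> energy g g"
    using exists_rayleigh_minimizer[OF assms] by metis
  define \<mu> where "\<mu> = energy v v"
  define EV where "EV = lap_eigenvalues S w"
  define m where "m = (\<lambda>l. fun_space.dim (lap_eigenspace S w l))"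
  have v_eig: "v \<in> lap_eigenspace S w \<mu>"
    unfolding \<mu>_def by (rule rayleigh_minimizer_eigen[OF v min])
  have "0 \<le> \<mu>"
    by (simp add: \<mu>_def energy_nonneg)
  have one: "indicator S \<in> lap_eigenspace S w 0" "ip (indicator S) (indicator S) \<noteq> 0"
    using indicator_eigenspace assms by (auto simp: ip_indicator)
  have "v \<noteq> (\<lambda>_. 0)"
    using v(3) by (auto simp: ip_def)
  moreover have "indicator S \<noteq> (\<lambda>_. 0 :: real)"
    using one(2) unfolding ip_def by force
  ultimately have EV: "0 \<in> EV" "\<mu> \<in> EV" "finite EV"
    using one v_eig finite_eigenvalues by (auto simp: EV_def lap_eigenvalues_def)
  have gap: "l = 0 \<or> \<mu> \<le> l" if "l \<in> EV" for l
  proof (cases "l = 0")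
    case False
    from that obtain f where f: "f \<in> lap_eigenspace S w l" "f \<noteq> (\<lambda>_. 0)"
      by (auto simp: EV_def lap_eigenvalues_def)
    have "sum f S = 0"
      using eigenspace_orthogonal[OF f(1) one(1) False] by (simp add: ip_indicator)
    hence "\<mu> * ip f f \<le> l * ip f f"
      using min[of f] eigenfunction_energy[OF f(1), of f] by (simp add: \<mu>_def)
    moreover have "ip f f > 0"
      using ip_nonneg[of f] eigenspace_zeroI[OF f(1)] f(2) by auto
    ultimately show ?thesis by simp
  qed simp
  hence Min0: "Min EV = 0"
    using EV \<open>0 \<le> \<mu>\<close> by (intro Min_eqI) (auto, force)
  have spec: "lap_spectrum S w = replicate (m 0) 0 @
      concat (map (\<lambda>l. replicate (m l) l) (sorted_list_of_set (EV - {0})))"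
  proof -
    have "sorted_list_of_set EV = 0 # sorted_list_of_set (EV - {0})"
      using sorted_list_of_set_nonempty[of EV] EV Min0 by auto
    thus ?thesis
      unfolding lap_spectrum_def EV_def[symmetric] m_def by (simp only: list.map concat.simps)
  qed
  have "lap_spectrum S w ! 1 = \<mu>"
  proof (cases "\<mu> = 0")
    case True
    \<comment> \<open>Now \<open>v\<close> is a second null function besides the constant, so index
      1 still lies in the block of zeros.\<close>
    have "fun_space.independent {indicator S, v}"
      by (rule orthogonal_independent)
        (use one v ip_commute[of v "indicator S"] in \<open>auto simp: ip_indicator\<close>)
    moreover have "indicator S \<noteq> v"
      using v(2) assms by (auto simp: sum_indicator_eq_card)
    ultimately have "2 \<le> m 0"
      using card_le_dim_eigenspace[of "{indicator S, v}" 0] one v_eig True by (simp add: m_def)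
    thus ?thesis
      using spec True by (simp add: nth_append)
  next
    case False
    \<comment> \<open>For \<open>\<mu> > 0\<close> a null function minus its mean has energy 0 and
      must vanish on \<open>S\<close>; thus 0 is listed exactly once and index 1 is the first entry
      after it.\<close>
    have "lap_eigenspace S w 0 \<subseteq> fun_space.span {indicator S}"
    proof
      fix f assume f: "f \<in> lap_eigenspace S w 0"
      define c where "c = sum f S / card S"
      have "sum (\<lambda>y. f y + - c) S = 0"
        using assms by (simp add: c_def sum_subtractf)
      from min[OF this] have "\<mu> * ip (\<lambda>y. f y + - c) (\<lambda>y. f y + - c) \<le> 0"
        unfolding energy_shift eigenfunction_energy[OF f] by (simp add: \<mu>_def)
      hence "ip (\<lambda>y. f y + - c) (\<lambda>y. f y + - c) = 0"
        using False \<open>0 \<le> \<mu>\<close> ip_nonneg[of "\<lambda>y. f y + - c"]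
        by (smt (verit) mult_pos_pos)
      hence "f = (\<lambda>y. c * indicator S y)"
        using ip_eq_0D[of "\<lambda>y. f y + - c"] f
        by (auto simp: fun_eq_iff indicator_def lap_eigenspace_def)
      thus "f \<in> fun_space.span {indicator S}"
        using fun_space.span_scale[OF fun_space.span_base[of "indicator S" "{indicator S}"], of c] by simp
    qed
    hence m0: "m 0 = 1"
      unfolding m_def
      by (intro fun_space.dim_unique[of "{indicator S}"] orthogonal_independent) (use one in auto)
    have "fun_space.independent {v}"
      by (rule orthogonal_independent) (use v in auto)
    hence m\<mu>: "1 \<le> m \<mu>"
      using card_le_dim_eigenspace[of "{v}" \<mu>] v_eig by (simp add: m_def)
    have "Min (EV - {0}) = \<mu>"
      using EV False gap by (intro Min_eqI) auto
    hence "sorted_list_of_set (EV - {0}) = \<mu> # sorted_list_of_set (EV - {0} - {\<mu>})"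
      using sorted_list_of_set_nonempty[of "EV - {0}"] EV False by auto
    thus ?thesis
      using spec m0 m\<mu> by (simp add: nth_append)
  qed
  thus ?thesis
    using that[of v] v min by (simp add: \<mu>_def)
qed

end

section \<open>Curvature of an out-regular vertex\<close>

text \<open>By well-ordering of \<open>enat\<close> the infimum over a nonempty set of walk lengths
  is attained; over the empty set it is \<open>\<infinity>\<close> and so never
  \<open>enat r\<close>.\<close>

lemma graph_dist_eq_enat_iff:
  "graph_dist E u v = enat r \<longleftrightarrow>
     (u, v) \<in> {(a, b). {a, b} \<in> E} ^^ r \<and> (\<forall>n<r. (u, v) \<notin> {(a, b). {a, b} \<in> E} ^^ n)"
    (is "?L \<longleftrightarrow> ?R")
proof -
  let ?A = "{enat n | n. (u, v) \<in> {(a, b). {a, b} \<in> E} ^^ n}"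
  have low: "graph_dist E u v \<le> enat n" if "(u, v) \<in> {(a, b). {a, b} \<in> E} ^^ n" for n
    unfolding graph_dist_def using that by (intro Inf_lower) auto
  have mem: "graph_dist E u v \<in> ?A" if "?A \<noteq> {}"
  proof -
    from that obtain k where "k \<in> ?A" by blast
    from wellorder_InfI[OF this] show ?thesis unfolding graph_dist_def .
  qed
  show ?thesis
  proof
    assume L: ?L
    have "?A \<noteq> {}"
    proof
      assume "?A = {}"
      hence "graph_dist E u v = \<infinity>"
        unfolding graph_dist_def by (simp only: Inf_empty top_enat_def)
      thus False using L by simp
    qed
    thus ?R
      using mem L low by (fastforce simp: not_le[symmetric])
  next
    assume R: ?R
    hence "?A \<noteq> {}" by blast
    from mem[OF this] obtain n where n: "graph_dist E u v = enat n"
      "(u, v) \<in> {(a, b). {a, b} \<in> E} ^^ n" by blast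
    have "n \<le> r"
      using R n(1) low[of r] by simp
    moreover have "\<not> n < r"
      using R n(2) by blast
    ultimately show ?L using n(1) by simp
  qed
qed

lemma in_nbrs_commute: "v \<in> nbrs E u \<longleftrightarrow> u \<in> nbrs E v"
  by (simp add: nbrs_def insert_commute)

lemma edge_weight_commute: "edge_weight E u v = edge_weight E v u"
  by (simp add: edge_weight_def insert_commute)

lemma edge_weight_nonneg: "0 \<le> edge_weight E u v"
  by (simp add: edge_weight_def)

lemma sum_edge_weight:
  assumes "finite A"
  shows "(\<Sum>v\<in>A. edge_weight E u v * h v) = sum h (nbrs E u \<inter> A)"
proof -
  have "(\<Sum>v\<in>A. edge_weight E u v * h v) = (\<Sum>v\<in>A. if v \<in> nbrs E u then h v else 0)"
    by (intro sum.cong refl) (simp add: edge_weight_def nbrs_def)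
  thus ?thesis
    using assms by (simp add: sum.inter_restrict[symmetric] Int_commute)
qed

section \<open>\<open>Gam\<close> and \<open>Gam2\<close> as sums over neighbours\<close>

lemma Gam_eq: "Gam E f g u = (\<Sum>v\<in>nbrs E u. (f v - f u) * (g v - g u)) / 2"
  unfolding Gam_def lap_def sum_distrib_left sum_subtractf[symmetric]
  by (intro arg_cong2[where f = "(/)"] sum.cong refl) (simp add: algebra_simps)

text \<open>The value \<open>Gam E f f x\<close> is subtracted once per neighbour, which gives the
  degree term; \<open>lap E f x\<close> factors out of \<open>2 * Gam E f (lap E f) x\<close>, which
  gives the square.\<close>

lemma Gam2_eq:
  "2 * Gam2 E f f x = (\<Sum>y\<in>nbrs E x. \<Sum>v\<in>nbrs E y.
       (f v - f y)\<^sup>2 / 2 - (f y - f x) * (f v - f y))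
     - real (card (nbrs E x)) * Gam E f f x + (\<Sum>y\<in>nbrs E x. f y - f x)\<^sup>2"
proof -
  have "2 * Gam2 E f f x = lap E (Gam E f f) x - 2 * Gam E f (lap E f) x"
    by (simp add: Gam2_def Gam_eq mult.commute)
  also have "2 * Gam E f (lap E f) x = (\<Sum>y\<in>nbrs E x. (f y - f x) * lap E f y)
      - (\<Sum>y\<in>nbrs E x. f y - f x) * lap E f x"
    by (simp add: Gam_eq right_diff_distrib sum_subtractf sum_distrib_right[symmetric])
  also have "lap E (Gam E f f) x = (\<Sum>y\<in>nbrs E x. Gam E f f y) - real (card (nbrs E x)) * Gam E f f x"
    by (simp add: lap_def sum_subtractf)
  also have "(\<Sum>y\<in>nbrs E x. Gam E f f y)
      = (\<Sum>y\<in>nbrs E x. \<Sum>v\<in>nbrs E y. (f v - f y)\<^sup>2 / 2)"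
    by (simp add: Gam_eq power2_eq_square sum_divide_distrib)
  also have "(\<Sum>y\<in>nbrs E x. (f y - f x) * lap E f y)
      = (\<Sum>y\<in>nbrs E x. \<Sum>v\<in>nbrs E y. (f y - f x) * (f v - f y))"
    by (simp add: lap_def sum_distrib_left)
  finally show ?thesis
    by (simp add: sum_subtractf power2_eq_square lap_def)
qed

text \<open>Here \<open>b\<close> is the value at a vertex of the two-sphere: the optimal one is twice the average of
  the values \<open>a\<close> at its neighbours in the one-sphere.\<close>

lemma complete_square_two_sphere:
  fixes c a :: "'b \<Rightarrow> real" and b :: real and A :: "'b set"
  defines "n \<equiv> sum c A"
  assumes "n \<noteq> 0"
  shows "(\<Sum>y\<in>A. c y * ((b - a y)\<^sup>2 / 2 - a y * (b - a y))) =
    n / 2 * (b - 2 / n * (\<Sum>y\<in>A. c y * a y))\<^sup>2 - (\<Sum>y\<in>A. c y * (a y)\<^sup>2) / 2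
    + (\<Sum>y\<in>A. \<Sum>y'\<in>A. c y * c y' / n * (a y' - a y)\<^sup>2)"
proof -
  define P where "P = (\<Sum>y\<in>A. c y * a y)"
  define R where "R = (\<Sum>y\<in>A. c y * (a y)\<^sup>2)"
  have "(\<Sum>y\<in>A. c y * ((b - a y)\<^sup>2 / 2 - a y * (b - a y)))
      = (\<Sum>y\<in>A. b\<^sup>2 / 2 * c y - 2 * b * (c y * a y) + 3 / 2 * (c y * (a y)\<^sup>2))"
    by (intro sum.cong refl) (simp add: power2_eq_square field_simps)
  also have "\<dots> = b\<^sup>2 / 2 * n - 2 * b * P + 3 / 2 * R"
    by (simp only: sum.distrib sum_subtractf sum_distrib_left[symmetric] P_def R_def n_def)
  finally have lhs: "(\<Sum>y\<in>A. c y * ((b - a y)\<^sup>2 / 2 - a y * (b - a y)))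
    = b\<^sup>2 / 2 * n - 2 * b * P + 3 / 2 * R" .
  \<comment> \<open>This double sum is a weighted variance, \<open>2 * R - 2 * P * P / n\<close>,
    exactly what is left over after completing the square in \<open>b\<close>.\<close>
  have "(\<Sum>y\<in>A. \<Sum>y'\<in>A. c y * c y' / n * (a y' - a y)\<^sup>2)
      = (\<Sum>y\<in>A. \<Sum>y'\<in>A. c y / n * (c y' * (a y')\<^sup>2) + c y * (a y)\<^sup>2 / n * c y'
          - 2 * (c y * a y) / n * (c y' * a y'))"
    by (intro sum.cong refl) (simp add: power2_eq_square algebra_simps add_divide_distrib diff_divide_distrib)
  also have "\<dots> = (\<Sum>y\<in>A. c y / n * R + c y * (a y)\<^sup>2 / n * n - 2 * (c y * a y) / n * P)"
    by (simp only: sum.distrib sum_subtractf sum_distrib_left[symmetric] P_def[symmetric] R_def[symmetric] n_def[symmetric])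
  also have "\<dots> = (\<Sum>y\<in>A. R / n * c y + c y * (a y)\<^sup>2 - 2 * P / n * (c y * a y))"
    using assms(2) by (intro sum.cong refl) (simp add: mult_ac)
  also have "\<dots> = R / n * n + R - 2 * P / n * P"
    by (simp only: sum.distrib sum_subtractf sum_distrib_left[symmetric] P_def[symmetric] R_def[symmetric] n_def[symmetric])
  finally have rhs: "(\<Sum>y\<in>A. \<Sum>y'\<in>A. c y * c y' / n * (a y' - a y)\<^sup>2) = R / n * n + R - 2 * P / n * P" .
  show ?thesis
    unfolding lhs rhs P_def[symmetric] R_def[symmetric] using assms(2)
    by (simp add: power2_eq_square field_simps)
qed

section \<open>Spheres around the root and the decomposition of \<open>Gam2\<close>\<close>

locale rooted_graph =
  fixes V :: "'a set" and E :: "'a set set" and x :: 'a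
  assumes graph: "locally_finite_simple_graph V E" and root: "x \<in> V"
begin

abbreviation "S1 \<equiv> sphere_at E 1 x"
abbreviation "S2 \<equiv> sphere_at E 2 x"

lemma not_in_nbrs_self: "u \<notin> nbrs E u"
  using graph unfolding locally_finite_simple_graph_def nbrs_def by fastforce

lemma nbrs_subset: "nbrs E u \<subseteq> V"
  using graph unfolding locally_finite_simple_graph_def nbrs_def by (fastforce simp: doubleton_eq_iff)

lemma finite_nbrs: "u \<in> V \<Longrightarrow> finite (nbrs E u)"
  using graph by (simp add: locally_finite_simple_graph_def nbrs_def)

lemma S1_eq: "S1 = nbrs E x"
  using not_in_nbrs_self[of x]
  by (auto simp: sphere_at_def graph_dist_eq_enat_iff nbrs_def)

lemma S2_eq: "S2 = (\<Union>y\<in>nbrs E x. nbrs E y) - nbrs E x - {x}"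
proof -
  have "(\<forall>n<2. P n) \<longleftrightarrow> P 0 \<and> P (1::nat)" for P
    by (auto simp: numeral_2_eq_2 less_Suc_eq)
  thus ?thesis
    by (auto simp: sphere_at_def graph_dist_eq_enat_iff nbrs_def numeral_2_eq_2 relcomp_unfold)
qed

text \<open>Otherwise the radius \<open>1\<close> in \<open>S1\<close> would be rewritten to
  \<open>Suc 0\<close>.\<close>

declare One_nat_def [simp del]

lemma finite_S1: "finite S1"
  using finite_nbrs[OF root] by (simp add: S1_eq)

lemma finite_S2: "finite S2"
  using nbrs_subset finite_nbrs finite_nbrs[OF root] by (auto simp: S2_eq)

lemma degree_eq: "vertex_degree E x = card S1"
  by (simp add: vertex_degree_def S1_eq)

text \<open>A neighbour of a vertex at distance 1 from \<open>x\<close> has distance 0, 1 or 2, and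
  only \<open>x\<close> has distance 0.\<close>

lemma sum_nbrs:
  assumes "y \<in> S1"
  shows "sum h (nbrs E y) = h x + (\<Sum>v\<in>S1. edge_weight E y v * h v) + (\<Sum>z\<in>S2. edge_weight E y z * h z)"
proof -
  have nbrs: "nbrs E y = insert x ((nbrs E y \<inter> S1) \<union> (nbrs E y \<inter> S2))"
    using assms in_nbrs_commute[of x E y] by (auto simp: S1_eq S2_eq)
  have "x \<notin> (nbrs E y \<inter> S1) \<union> (nbrs E y \<inter> S2)"
    using not_in_nbrs_self by (auto simp: S1_eq S2_eq)
  moreover have "(nbrs E y \<inter> S1) \<inter> (nbrs E y \<inter> S2) = {}"
    by (auto simp: S1_eq S2_eq)
  ultimately have "sum h (insert x ((nbrs E y \<inter> S1) \<union> (nbrs E y \<inter> S2))) = h x + (sum h (nbrs E y \<inter> S1) + sum h (nbrs E y \<inter> S2))"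
    using finite_S1 finite_S2 by (simp add: sum.union_disjoint)
  thus ?thesis
    by (simp add: sum_edge_weight finite_S1 finite_S2 nbrs[symmetric])
qed

lemma out_degree_eq: "real (out_degree E x y) = (\<Sum>z\<in>S2. edge_weight E y z)"
  using sum_edge_weight[OF finite_S2, of E y "\<lambda>_. 1"] by (simp add: out_degree_def)

lemma in_degree_eq: "real (in_degree E x z) = (\<Sum>y\<in>S1. edge_weight E y z)"
  using sum_edge_weight[OF finite_S1, of E z "\<lambda>_. 1"]
  by (simp add: in_degree_def edge_weight_commute[of E z])

lemma in_degree_pos: "z \<in> S2 \<Longrightarrow> 0 < in_degree E x z"
  using finite_S1 unfolding in_degree_def card_gt_0_iff
  by (auto simp: S1_eq S2_eq in_nbrs_commute[of z])

sublocale finite_network S1 "weight2 E x"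
proof
  show "finite S1" by (rule finite_S1)
  show "weight2 E x y y' = weight2 E x y' y" for y y'
    by (simp add: weight2_def weight1_def edge_weight_commute mult.commute)
  show "0 \<le> weight2 E x y y'" for y y'
    unfolding weight2_def weight1_def
    by (intro add_nonneg_nonneg sum_nonneg divide_nonneg_nonneg mult_nonneg_nonneg edge_weight_nonneg) auto
qed

text \<open>What \<open>2 Gam2\<close> exceeds its minimum over the values on the two-sphere by.\<close>

definition defect :: "('a \<Rightarrow> real) \<Rightarrow> real" where
  "defect a = (\<Sum>z\<in>S2. real (in_degree E x z) / 2 *
     (a z - 2 / real (in_degree E x z) * (\<Sum>y\<in>S1. edge_weight E y z * a y))\<^sup>2)"

text \<open>The neighbours of each \<open>y\<close> split into three kinds. The root gives a
  multiple of \<open>ip a a\<close>; edges inside \<open>S1\<close>, after symmetrisation, give the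
  energy for \<open>edge_weight\<close>; edges to \<open>S2\<close>, after completing the square at
  each \<open>z\<close>, give the energy for \<open>weight1\<close>, the out degree term and
  \<open>defect\<close>.\<close>

lemma Gam2_decomposition:
  fixes f :: "'a \<Rightarrow> real"
  defines "a \<equiv> \<lambda>v. f v - f x"
  shows "2 * Gam2 E f f x = (3 - real (card S1)) / 2 * ip a a
    - (\<Sum>y\<in>S1. real (out_degree E x y) * (a y)\<^sup>2) / 2
    + (sum a S1)\<^sup>2 + 2 * energy a a + defect a"
proof -
  \<comment> \<open>The contribution of a neighbour with value \<open>t\<close> at a vertex with
    value \<open>s\<close>, both relative to \<open>f x\<close>.\<close>
  define q where "q = (\<lambda>s t :: real. (t - s)\<^sup>2 / 2 - s * (t - s))"
  have a_x: "a x = 0"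
    by (simp add: a_def)
  have q_sym: "q s t + q t s = 2 * (t - s)\<^sup>2" for s t
    by (simp add: q_def power2_eq_square algebra_simps)
  have "(\<Sum>y\<in>S1. \<Sum>v\<in>nbrs E y. (f v - f y)\<^sup>2 / 2 - (f y - f x) * (f v - f y))
      = (\<Sum>y\<in>S1. \<Sum>v\<in>nbrs E y. q (a y) (a v))"
    by (simp add: q_def a_def)
  also have "\<dots> = (\<Sum>y\<in>S1. q (a y) (a x) + (\<Sum>v\<in>S1. edge_weight E y v * q (a y) (a v))
      + (\<Sum>z\<in>S2. edge_weight E y z * q (a y) (a z)))"
    by (intro sum.cong refl sum_nbrs)
  also have "\<dots> = (\<Sum>y\<in>S1. q (a y) (a x)) + (\<Sum>y\<in>S1. \<Sum>v\<in>S1. edge_weight E y v * q (a y) (a v))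
      + (\<Sum>y\<in>S1. \<Sum>z\<in>S2. edge_weight E y z * q (a y) (a z))"
    by (simp add: sum.distrib)
  also have "(\<Sum>y\<in>S1. q (a y) (a x)) = 3 / 2 * ip a a"
    unfolding ip_def sum_distrib_left by (intro sum.cong refl) (simp add: q_def a_x power2_eq_square field_simps)
  also have "(\<Sum>y\<in>S1. \<Sum>v\<in>S1. edge_weight E y v * q (a y) (a v))
      = (\<Sum>y\<in>S1. \<Sum>v\<in>S1. edge_weight E y v * (a v - a y)\<^sup>2)" (is "?A = ?B")
  \<comment> \<open>Each edge inside \<open>S1\<close> is met in both orders, so \<open>q\<close>
    may be replaced by its symmetrisation from \<open>q_sym\<close>.\<close>
  proof -
    have "?A = (\<Sum>y\<in>S1. \<Sum>v\<in>S1. edge_weight E y v * q (a v) (a y))"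
      by (subst sum.swap) (simp add: edge_weight_commute)
    hence "2 * ?A = (\<Sum>y\<in>S1. \<Sum>v\<in>S1. edge_weight E y v * (q (a y) (a v) + q (a v) (a y)))"
      by (simp add: distrib_left sum.distrib)
    also have "\<dots> = 2 * ?B"
      unfolding q_sym sum_distrib_left by (simp add: mult_ac)
    finally show ?thesis by simp
  qed
  also have "(\<Sum>y\<in>S1. \<Sum>z\<in>S2. edge_weight E y z * q (a y) (a z))
      = defect a - (\<Sum>y\<in>S1. real (out_degree E x y) * (a y)\<^sup>2) / 2
        + (\<Sum>y\<in>S1. \<Sum>v\<in>S1. weight1 E x y v * (a v - a y)\<^sup>2)"
  proof -
    have "(\<Sum>y\<in>S1. \<Sum>z\<in>S2. edge_weight E y z * q (a y) (a z))
        = (\<Sum>z\<in>S2. \<Sum>y\<in>S1. edge_weight E y z * q (a y) (a z))"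
      by (rule sum.swap)
    also have "\<dots> = (\<Sum>z\<in>S2. real (in_degree E x z) / 2 *
         (a z - 2 / real (in_degree E x z) * (\<Sum>y\<in>S1. edge_weight E y z * a y))\<^sup>2
       - (\<Sum>y\<in>S1. edge_weight E y z * (a y)\<^sup>2) / 2
       + (\<Sum>y\<in>S1. \<Sum>v\<in>S1. edge_weight E y z * edge_weight E v z / real (in_degree E x z) * (a v - a y)\<^sup>2))"
    proof (rule sum.cong[OF refl])
      fix z assume "z \<in> S2"
      hence "(\<Sum>y\<in>S1. edge_weight E y z) \<noteq> 0"
        using in_degree_pos[of z] in_degree_eq[of z] by simp
      from complete_square_two_sphere[OF this, of "a z" a]
      show "(\<Sum>y\<in>S1. edge_weight E y z * q (a y) (a z)) = real (in_degree E x z) / 2 *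
         (a z - 2 / real (in_degree E x z) * (\<Sum>y\<in>S1. edge_weight E y z * a y))\<^sup>2
       - (\<Sum>y\<in>S1. edge_weight E y z * (a y)\<^sup>2) / 2
       + (\<Sum>y\<in>S1. \<Sum>v\<in>S1. edge_weight E y z * edge_weight E v z / real (in_degree E x z) * (a v - a y)\<^sup>2)"
        unfolding in_degree_eq q_def .
    qed
    also have "\<dots> = defect a - (\<Sum>z\<in>S2. \<Sum>y\<in>S1. edge_weight E y z * (a y)\<^sup>2) / 2
       + (\<Sum>z\<in>S2. \<Sum>y\<in>S1. \<Sum>v\<in>S1. edge_weight E y z * edge_weight E v z / real (in_degree E x z) * (a v - a y)\<^sup>2)"
      by (simp add: sum.distrib sum_subtractf defect_def sum_divide_distrib)
    also have "(\<Sum>z\<in>S2. \<Sum>y\<in>S1. edge_weight E y z * (a y)\<^sup>2)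
        = (\<Sum>y\<in>S1. real (out_degree E x y) * (a y)\<^sup>2)"
      by (subst sum.swap) (simp add: out_degree_eq sum_distrib_right)
    also have "(\<Sum>z\<in>S2. \<Sum>y\<in>S1. \<Sum>v\<in>S1.
          edge_weight E y z * edge_weight E v z / real (in_degree E x z) * (a v - a y)\<^sup>2)
        = (\<Sum>y\<in>S1. \<Sum>z\<in>S2. \<Sum>v\<in>S1.
          edge_weight E y z * edge_weight E v z / real (in_degree E x z) * (a v - a y)\<^sup>2)"
      by (rule sum.swap)
    also have "\<dots> = (\<Sum>y\<in>S1. \<Sum>v\<in>S1. \<Sum>z\<in>S2.
          edge_weight E y z * edge_weight E v z / real (in_degree E x z) * (a v - a y)\<^sup>2)"
      by (intro sum.cong refl sum.swap)
    also have "\<dots> = (\<Sum>y\<in>S1. \<Sum>v\<in>S1. weight1 E x y v * (a v - a y)\<^sup>2)"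
      by (simp add: weight1_def sum_distrib_right edge_weight_commute)
    finally show ?thesis .
  qed
  finally have sum_q: "(\<Sum>y\<in>S1. \<Sum>v\<in>nbrs E y. (f v - f y)\<^sup>2 / 2 - (f y - f x) * (f v - f y))
     = 3 / 2 * ip a a + 2 * energy a a + defect a
       - (\<Sum>y\<in>S1. real (out_degree E x y) * (a y)\<^sup>2) / 2"
    by (simp add: energy_def weight2_def distrib_right sum.distrib power2_eq_square[symmetric])
  have Gam: "Gam E f f x = ip a a / 2"
    by (simp add: Gam_eq ip_def a_def flip: S1_eq)
  have sum_a: "(\<Sum>y\<in>S1. f y - f x) = sum a S1"
    by (simp add: a_def)
  show ?thesis
    unfolding Gam2_eq S1_eq[symmetric] sum_q Gam sum_a by (simp add: field_simps)
qed

section \<open>Reduction to a quadratic form on the one-sphere\<close>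

lemma exists_defect_zero_extension:
  fixes b :: "'a \<Rightarrow> real"
  obtains f where "f x = 0" "\<And>y. y \<in> S1 \<Longrightarrow> f y = b y" "defect f = 0"
proof -
  \<comment> \<open>The squares in \<open>defect\<close> involve distinct vertices \<open>z\<close>,
    so all of them can be made zero at once, whatever the values on \<open>S1\<close>. The value 0
    at \<open>x\<close> makes \<open>f\<close> equal to its own \<open>a\<close>.\<close>
  define f where "f = (\<lambda>v. if v = x then 0 else if v \<in> S1 then b v
    else 2 / real (in_degree E x v) * (\<Sum>y\<in>S1. edge_weight E y v * b y))"
  have "f x = 0"
    by (simp add: f_def)
  have fS1: "f y = b y" if "y \<in> S1" for y
    using that not_in_nbrs_self by (auto simp: f_def S1_eq)
  have "f z = 2 / real (in_degree E x z) * (\<Sum>y\<in>S1. edge_weight E y z * f y)" if "z \<in> S2" for z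
  proof -
    have "(\<Sum>y\<in>S1. edge_weight E y z * f y) = (\<Sum>y\<in>S1. edge_weight E y z * b y)"
      by (intro sum.cong refl) (simp add: fS1)
    moreover have "z \<noteq> x" "z \<notin> S1"
      using that by (auto simp: S1_eq S2_eq)
    ultimately show ?thesis by (simp add: f_def)
  qed
  hence "defect f = 0"
    unfolding defect_def by (intro sum.neutral ballI) simp
  with \<open>f x = 0\<close> fS1 show ?thesis
    by (rule that)
qed

lemma defect_nonneg: "0 \<le> defect a"
  unfolding defect_def by (intro sum_nonneg mult_nonneg_nonneg) auto

text \<open>The inequality is doubled, with \<open>2 * Gam E f f x\<close> equal to
  \<open>ip a a\<close>. Forwards it is applied to an extension with zero defect; backwards the
  nonnegative defect is dropped.\<close>

lemma curvature_condition_iff: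
  assumes "\<And>y. y \<in> S1 \<Longrightarrow> real (out_degree E x y) = D"
  shows "(\<forall>f. Gam2 E f f x \<ge> \<nu> * (lap E f x)\<^sup>2 + K * Gam E f f x) \<longleftrightarrow>
    (\<forall>a. K * ip a a \<le> (3 - real (card S1) - D) / 2 * ip a a + (1 - 2 * \<nu>) * (sum a S1)\<^sup>2 + 2 * energy a a)"
    (is "?L \<longleftrightarrow> (\<forall>a. ?R a)")
proof -
  have Gam: "Gam E f f x = ip (\<lambda>v. f v - f x) (\<lambda>v. f v - f x) / 2"
    and lap: "lap E f x = sum (\<lambda>v. f v - f x) S1" for f
    by (simp_all add: Gam_eq ip_def lap_def flip: S1_eq)
  have Gam2: "2 * Gam2 E f f x = (3 - real (card S1) - D) / 2 * ip a a + (sum a S1)\<^sup>2 + 2 * energy a a + defect a"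
    if "a = (\<lambda>v. f v - f x)" for f a
  proof -
    have "(\<Sum>y\<in>S1. real (out_degree E x y) * (a y)\<^sup>2) = D * ip a a"
      unfolding ip_def sum_distrib_left
      by (intro sum.cong refl) (simp add: assms power2_eq_square)
    thus ?thesis
      using Gam2_decomposition[of f] that by (simp add: field_simps)
  qed
  show ?thesis
  proof (intro iffI allI)
    fix b assume L: ?L
    obtain f where f: "f x = 0" "\<And>y. y \<in> S1 \<Longrightarrow> f y = b y" "defect f = 0"
      using exists_defect_zero_extension[of b] by metis
    have "ip f f = ip b b" "energy f f = energy b b" "sum f S1 = sum b S1"
      by (simp_all add: ip_def energy_def f(2))
    thus "?R b"
      using L[rule_format, of f] Gam2[of f f] Gam[of f] lap[of f] f by (simp add: field_simps)
  next
    fix f :: "'a \<Rightarrow> real" assume R: "\<forall>a. ?R a"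
    define a where "a = (\<lambda>v. f v - f x)"
    show "Gam2 E f f x \<ge> \<nu> * (lap E f x)\<^sup>2 + K * Gam E f f x"
      using R[rule_format, of a] Gam2[OF a_def] defect_nonneg[of a]
      unfolding Gam[of f, folded a_def] lap[of f, folded a_def] by (simp add: field_simps)
  qed
qed

text \<open>That the minimum is admissible follows from the orthogonal splitting into a mean-zero
  part and a constant; that nothing larger is admissible follows by testing with the Rayleigh
  minimiser and with the constant 1.\<close>

lemma BE_curvature_eq_min:
  assumes regular: "S1_out_regular E x" and deg: "card S1 \<ge> 2"
  shows "BE_curvature E x N =
    min ((3 + real (card S1) - av_out_degree E x) / 2 - 2 * real (card S1) * real_of_ereal (1 / N))
        ((3 - real (card S1) - av_out_degree E x) / 2 + 2 * lambda1 E x)"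
proof -
  define d where "d = real (card S1)"
  define D where "D = av_out_degree E x"
  define \<nu> where "\<nu> = real_of_ereal (1 / N)"
  define \<mu> where "\<mu> = lambda1 E x"
  define K0 where "K0 = min ((3 + d - D) / 2 - 2 * d * \<nu>) ((3 - d - D) / 2 + 2 * \<mu>)"
  have d: "d > 0" using deg by (simp add: d_def)
  have out: "real (out_degree E x y) = D" if "y \<in> S1" for y
  proof -
    have "out_degree E x y' = out_degree E x y" if "y' \<in> S1" for y'
      using regular[unfolded S1_out_regular_def, rule_format, OF that \<open>y \<in> S1\<close>] .
    hence "(\<Sum>y'\<in>S1. real (out_degree E x y')) = (\<Sum>y'\<in>S1. real (out_degree E x y))"
      by (intro sum.cong refl) (simp only:)
    thus ?thesis
      using d by (simp add: D_def av_out_degree_def degree_eq d_def)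
  qed
  obtain v where v: "sum v S1 = 0" "ip v v = 1" "energy v v = \<mu>"
    and gap: "\<And>g. sum g S1 = 0 \<Longrightarrow> \<mu> * ip g g \<le> energy g g"
    using lap_spectrum_second[OF deg, folded lambda1_def, folded \<mu>_def] by blast
  have iff: "(\<forall>f. Gam2 E f f x \<ge> \<nu> * (lap E f x)\<^sup>2 + K * Gam E f f x) \<longleftrightarrow>
      (\<forall>a. K * ip a a \<le> (3 - d - D) / 2 * ip a a + (1 - 2 * \<nu>) * (sum a S1)\<^sup>2 + 2 * energy a a)" for K
    unfolding d_def by (rule curvature_condition_iff[OF out])
  have "BE_curvature E x N = K0"
    unfolding BE_curvature_def \<nu>_def[symmetric] iff
  proof (rule Greatest_equality)
    show "\<forall>a. K0 * ip a a \<le> (3 - d - D) / 2 * ip a a + (1 - 2 * \<nu>) * (sum a S1)\<^sup>2 + 2 * energy a a"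
    proof
      fix a :: "'a \<Rightarrow> real"
      define s where "s = sum a S1"
      \<comment> \<open>The mean-zero part of \<open>a\<close>: it is orthogonal to the constant
        part \<open>s / d\<close> and has the same energy as \<open>a\<close>.\<close>
      define g where "g = (\<lambda>y. a y + - (s / d))"
      have sg: "sum g S1 = 0"
        using d by (simp add: g_def sum_subtractf s_def d_def)
      have "ip a a = ip (\<lambda>y. g y + s / d * indicator S1 y) (\<lambda>y. g y + s / d * indicator S1 y)"
        unfolding ip_def by (intro sum.cong refl) (simp add: g_def)
      also have "\<dots> = ip g g + s\<^sup>2 / d"
        unfolding ip_expand using sg d
        by (simp add: ip_indicator d_def[symmetric] power2_eq_square)
      finally have ipa: "ip a a = ip g g + s\<^sup>2 / d" .
      have en: "energy a a = energy g g"
        unfolding g_def energy_shift ..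
      have "K0 * ip g g \<le> ((3 - d - D) / 2 + 2 * \<mu>) * ip g g"
        by (intro mult_right_mono ip_nonneg) (simp add: K0_def)
      also have "\<dots> \<le> (3 - d - D) / 2 * ip g g + 2 * energy g g"
        using gap[OF sg] by (simp add: algebra_simps)
      finally have 1: "K0 * ip g g \<le> (3 - d - D) / 2 * ip g g + 2 * energy g g" .
      have "K0 * (s\<^sup>2 / d) \<le> ((3 + d - D) / 2 - 2 * d * \<nu>) * (s\<^sup>2 / d)"
        using d by (intro mult_right_mono) (auto simp: K0_def)
      \<comment> \<open>The two constants \<open>(3 + d - D) / 2\<close> and
        \<open>(3 - d - D) / 2\<close> differ by \<open>d\<close>, which cancels the
        denominator.\<close>
      also have "\<dots> = (3 - d - D) / 2 * (s\<^sup>2 / d) + (1 - 2 * \<nu>) * s\<^sup>2"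
        using d by (simp add: field_simps)
      finally show "K0 * ip a a \<le> (3 - d - D) / 2 * ip a a + (1 - 2 * \<nu>) * (sum a S1)\<^sup>2 + 2 * energy a a"
        using 1 unfolding ipa en s_def[symmetric] by (simp add: distrib_left)
    qed
  next
    fix K assume K: "\<forall>a. K * ip a a \<le> (3 - d - D) / 2 * ip a a + (1 - 2 * \<nu>) * (sum a S1)\<^sup>2 + 2 * energy a a"
    have "K \<le> (3 - d - D) / 2 + 2 * \<mu>"
      using K[rule_format, of v] v by simp
    moreover have "K * d \<le> ((3 + d - D) / 2 - 2 * d * \<nu>) * d"
      \<comment> \<open>The constant 1 has energy 0, while its sum and its \<open>ip\<close> with
        itself both equal \<open>d\<close>.\<close>
      using K[rule_format, of "\<lambda>_. 1"]
      by (simp add: ip_def energy_def d_def[symmetric] power2_eq_square field_simps)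
    hence "K \<le> (3 + d - D) / 2 - 2 * d * \<nu>"
      using d by simp
    ultimately show "K \<le> K0" by (simp add: K0_def)
  qed
  thus ?thesis
    by (simp add: K0_def d_def D_def \<nu>_def \<mu>_def)
qed

end

section \<open>Comparison of the two bounds on the curvature\<close>

theorem theorem9p1:
  fixes V :: "'a set" and E :: "'a set set" and x :: 'a and d :: nat and lam :: real
  assumes "locally_finite_simple_graph V E"
    and "x \<in> V"
    and "S1_out_regular E x"
    and "d = vertex_degree E x"
    and "d \<ge> 2"
    and "lam = lambda1 E x"
  shows "(lam \<ge> real d / 2 \<longleftrightarrow> infty_curvature_sharp E x) \<and>
    (lam \<ge> real d / 2 \<longrightarrow>
      (\<forall>N::ereal. 0 < N \<longrightarrow>
        BE_curvature E x N =
          (3 + real d - av_out_degree E x) / 2 - 2 * real d * real_of_ereal (1 / N))) \<and>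
    (lam < real d / 2 \<longrightarrow>
      (\<forall>N::ereal. 0 < N \<longrightarrow>
        BE_curvature E x N =
          (if N \<le> ereal (2 * real d / (real d - 2 * lam))
           then (3 + real d - av_out_degree E x) / 2 - 2 * real d * real_of_ereal (1 / N)
           else (3 - real d - av_out_degree E x) / 2 + 2 * lam)))"
proof -
  interpret rooted_graph V E x
    by unfold_locales (use assms in auto)
  have curv: "BE_curvature E x N =
    min ((3 + real d - av_out_degree E x) / 2 - 2 * real d * real_of_ereal (1 / N))
        ((3 - real d - av_out_degree E x) / 2 + 2 * lam)" for N
    using BE_curvature_eq_min[OF assms(3)] assms(4-6) by (simp add: degree_eq)
  have nonneg: "0 \<le> 2 * real d * real_of_ereal (1 / N)" if "0 < N" for N :: ereal
    using that by (cases N) (auto simp: one_ereal_def)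
  \<comment> \<open>The right-hand side says that the first bound is at most the second. At
    \<open>N = \<infinity>\<close> both sides are false, because \<open>real d - 2 * lam\<close> is
    positive.\<close>
  have threshold: "N \<le> ereal (2 * real d / (real d - 2 * lam)) \<longleftrightarrow>
      real d - 2 * lam \<le> 2 * real d * real_of_ereal (1 / N)"
    if "0 < N" "lam < real d / 2" for N :: ereal
    using that by (cases N) (auto simp: one_ereal_def field_simps)
  \<comment> \<open>At \<open>N = \<infinity>\<close> the first bound is the sharp value itself, and
    it is the minimum exactly if \<open>real d \<le> 2 * lam\<close>.\<close>
  have sharp: "infty_curvature_sharp E x \<longleftrightarrow> lam \<ge> real d / 2"
    unfolding infty_curvature_sharp_def curv assms(4)[symmetric] by (auto simp: min_def field_simps)
  have large: "BE_curvature E x N =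
      (3 + real d - av_out_degree E x) / 2 - 2 * real d * real_of_ereal (1 / N)"
    if "lam \<ge> real d / 2" "0 < N" for N :: ereal
    unfolding curv using that nonneg[of N] by (simp add: min_def field_simps)
  have small: "BE_curvature E x N =
      (if N \<le> ereal (2 * real d / (real d - 2 * lam))
       then (3 + real d - av_out_degree E x) / 2 - 2 * real d * real_of_ereal (1 / N)
       else (3 - real d - av_out_degree E x) / 2 + 2 * lam)"
    if "lam < real d / 2" "0 < N" for N :: ereal
    unfolding curv threshold[OF that(2,1)] by (auto simp: min_def field_simps)
  show ?thesis
    using sharp large small by blast
qed

end
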